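(* Any finite semigroup can be embedded in a $2$-generated semigroup that is finite and regular.
   Context: An embedding is an injective semigroup homomorphism. A semigroup is $2$-generated if it is generated, as a semigroup, by two elements. A semigroup $T$ is regular if for each $a\in T$ there is $x\in T$ with $a=axa$. *)

theory Defs
  imports Main
begin

text \<open>
  HOL's locale \<open>semigroup\<close> lives on a whole type. Here both the given semigroup and the one whose
  existence is claimed are arbitrary sets with a binary operation, and only the values of the
  operation on the carrier matter. The empty carrier is not excluded.
\<close>

locale semigroup_on =
  fixes S :: "'a set" and mul :: "'a \<Rightarrow> 'a \<Rightarrow> 'a"
  assumes closed: "\<lbrakk>x \<in> S; y \<in> S\<rbrakk> \<Longrightarrow> mul x y \<in> S"
    and assoc: "\<lbrakk>x \<in> S; y \<in> S; z \<in> S\<rbrakk> \<Longrightarrow> mul (mul x y) z = mul x (mul y z)"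

definition semigroup_hom_on ::
    "'a set \<Rightarrow> ('a \<Rightarrow> 'a \<Rightarrow> 'a) \<Rightarrow> 'b set \<Rightarrow> ('b \<Rightarrow> 'b \<Rightarrow> 'b) \<Rightarrow> ('a \<Rightarrow> 'b) \<Rightarrow> bool" where
  "semigroup_hom_on S mul T mul' h \<longleftrightarrow>
     h ` S \<subseteq> T \<and> (\<forall>x\<in>S. \<forall>y\<in>S. h (mul x y) = mul' (h x) (h y))"

definition semigroup_embedding ::
    "'a set \<Rightarrow> ('a \<Rightarrow> 'a \<Rightarrow> 'a) \<Rightarrow> 'b set \<Rightarrow> ('b \<Rightarrow> 'b \<Rightarrow> 'b) \<Rightarrow> ('a \<Rightarrow> 'b) \<Rightarrow> bool" where
  "semigroup_embedding S mul T mul' h \<longleftrightarrow> semigroup_hom_on S mul T mul' h \<and> inj_on h S"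

inductive_set subsemigroup_generated :: "('a \<Rightarrow> 'a \<Rightarrow> 'a) \<Rightarrow> 'a set \<Rightarrow> 'a set"
  for mul :: "'a \<Rightarrow> 'a \<Rightarrow> 'a" and X :: "'a set" where
  base: "x \<in> X \<Longrightarrow> x \<in> subsemigroup_generated mul X"
| mult: "\<lbrakk>x \<in> subsemigroup_generated mul X; y \<in> subsemigroup_generated mul X\<rbrakk>
    \<Longrightarrow> mul x y \<in> subsemigroup_generated mul X"

text \<open>The two generators are allowed to coincide, so monogenic semigroups count as 2-generated.\<close>

definition two_generated :: "'a set \<Rightarrow> ('a \<Rightarrow> 'a \<Rightarrow> 'a) \<Rightarrow> bool" where
  "two_generated T mul \<longleftrightarrow> (\<exists>a\<in>T. \<exists>b\<in>T. T = subsemigroup_generated mul {a, b})"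

definition regular_semigroup :: "'a set \<Rightarrow> ('a \<Rightarrow> 'a \<Rightarrow> 'a) \<Rightarrow> bool" where
  "regular_semigroup T mul \<longleftrightarrow> (\<forall>a\<in>T. \<exists>x\<in>T. a = mul (mul a x) a)"

end

theory Submission
  imports Defs "HOL-Library.FuncSet"
begin

text \<open>
  Left multiplication on the semigroup with an identity adjoined embeds the semigroup in a full
  transformation monoid \<open>M\<close>, which is finite and regular. Let \<open>n\<close> be the order of \<open>M\<close>, let \<open>p\<close>
  map the cyclic group of order \<open>n\<close> onto \<open>M\<close>, and consider the Rees matrix semigroup over \<open>M\<close>
  whose rows and columns are indexed by the cyclic group and whose sandwich matrix has the entry
  \<open>p (j + k)\<close> at \<open>(j, k)\<close>. The cyclic group acts on both sides by shifting the indices, and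
  adjoining it gives a semigroup generated by the shift \<open>c\<close> and the triple \<open>x = (0, 1, 0)\<close>: the
  products \<open>x c\<^sup>k x = (0, p k, 0)\<close> already exhaust \<open>{0} \<times> M \<times> {0}\<close>. Since every row and every column
  of the sandwich matrix contains the identity, regularity is inherited from \<open>M\<close>, and \<open>M\<close> embeds.
\<close>

section \<open>Transport along a bijection\<close>

text \<open>Serves to carry a pair of generators over to an isomorphic copy.\<close>

lemma semigroup_hom_generated_image:
  assumes "semigroup_hom_on T mul U mul' e" and "semigroup_on T mul" and "X \<subseteq> T"
  shows "e ` subsemigroup_generated mul X = subsemigroup_generated mul' (e ` X)"
proof
  have hom: "\<And>x y. x \<in> T \<Longrightarrow> y \<in> T \<Longrightarrow> e (mul x y) = mul' (e x) (e y)"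
    using assms(1) by (simp add: semigroup_hom_on_def)
  have sub: "x \<in> T" if "x \<in> subsemigroup_generated mul X" for x
    using that
    by induction (use assms(2,3) in \<open>auto intro: semigroup_on.closed\<close>)
  have "e x \<in> subsemigroup_generated mul' (e ` X)" if "x \<in> subsemigroup_generated mul X" for x
    using that
    by induction (auto simp: hom sub intro: subsemigroup_generated.intros)
  then show "e ` subsemigroup_generated mul X \<subseteq> subsemigroup_generated mul' (e ` X)" by blast
  have "y \<in> e ` subsemigroup_generated mul X" if "y \<in> subsemigroup_generated mul' (e ` X)" for y
    using that
  proof induction
    case (base y)
    then show ?case by (auto intro: subsemigroup_generated.base)
  next
    case (mult y z)
    then obtain u v where "y = e u" "z = e v"
      and uv: "u \<in> subsemigroup_generated mul X" "v \<in> subsemigroup_generated mul X" by auto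
    then have "mul' y z = e (mul u v)" by (simp add: hom sub)
    with uv show ?case by (auto intro: subsemigroup_generated.mult)
  qed
  then show "subsemigroup_generated mul' (e ` X) \<subseteq> e ` subsemigroup_generated mul X" by blast
qed

text \<open>HOL cannot quantify existentially over types, so the final claim fixes the carrier
  inside \<open>nat\<close>. Any finite semigroup, over whatever type it was built, has a copy
  there.\<close>

lemma semigroup_transport_nat:
  fixes T :: "'b set" and mul :: "'b \<Rightarrow> 'b \<Rightarrow> 'b"
  assumes sg: "semigroup_on T mul" and fin: "finite T"
    and reg: "regular_semigroup T mul" and gen: "two_generated T mul"
  obtains T' :: "nat set" and mul' :: "nat \<Rightarrow> nat \<Rightarrow> nat" and e
  where "semigroup_on T' mul'" "finite T'" "regular_semigroup T' mul'" "two_generated T' mul'"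
    "semigroup_embedding T mul T' mul' e"
proof -
  interpret semigroup_on T mul by (fact sg)
  obtain e :: "'b \<Rightarrow> nat" where inj: "inj_on e T"
    using finite_imp_inj_to_nat_seg[OF fin] by blast
  define mul' where "mul' a b = e (mul (inv_into T e a) (inv_into T e b))" for a b
  have mul': "mul' (e x) (e y) = e (mul x y)" if "x \<in> T" "y \<in> T" for x y
    using that inj by (simp add: mul'_def)
  have emb: "semigroup_embedding T mul (e ` T) mul' e"
    using inj by (simp add: semigroup_embedding_def semigroup_hom_on_def mul')
  have "semigroup_on (e ` T) mul'"
    by unfold_locales (auto simp: mul' closed assoc)
  moreover have "regular_semigroup (e ` T) mul'"
    unfolding regular_semigroup_def
  proof
    fix a assume "a \<in> e ` T"
    then obtain s where s: "s \<in> T" "a = e s" by auto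
    with reg obtain x where x: "x \<in> T" "s = mul (mul s x) s"
      unfolding regular_semigroup_def by blast
    then have "a = mul' (mul' a (e x)) a" using s by (simp add: mul' closed)
    with x show "\<exists>x\<in>e ` T. a = mul' (mul' a x) a" by blast
  qed
  moreover have "two_generated (e ` T) mul'"
  proof -
    from gen obtain a b where ab: "a \<in> T" "b \<in> T" "T = subsemigroup_generated mul {a, b}"
      unfolding two_generated_def by blast
    have "e ` T = subsemigroup_generated mul' {e a, e b}"
      using semigroup_hom_generated_image[of T mul "e ` T" mul' e "{a, b}"] emb sg ab
      by (simp add: semigroup_embedding_def)
    with ab show ?thesis unfolding two_generated_def by blast
  qed
  ultimately show thesis using that emb fin by blast
qed

lemma semigroup_embedding_comp:
  assumes "semigroup_embedding S mulS T mulT f" and "semigroup_embedding T mulT U mulU g"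
  shows "semigroup_embedding S mulS U mulU (g \<circ> f)"
  using assms unfolding semigroup_embedding_def semigroup_hom_on_def
  by (auto intro: comp_inj_on inj_on_subset simp: image_subset_iff)

section \<open>Rees matrix semigroups with shifts\<close>

locale regular_monoid_on = semigroup_on M mul
  for M :: "'b set" and mul :: "'b \<Rightarrow> 'b \<Rightarrow> 'b" (infixl "\<cdot>" 70) +
  fixes e :: 'b
  assumes unit_closed: "e \<in> M"
    and unit_left: "x \<in> M \<Longrightarrow> e \<cdot> x = x"
    and unit_right: "x \<in> M \<Longrightarrow> x \<cdot> e = x"
    and regular: "regular_semigroup M (\<cdot>)"

datatype 'b rees_shift = Shift nat | Triple nat 'b nat

fun rees_shift_mul ::
    "nat \<Rightarrow> (nat \<Rightarrow> 'b) \<Rightarrow> ('b \<Rightarrow> 'b \<Rightarrow> 'b) \<Rightarrow> 'b rees_shift \<Rightarrow> 'b rees_shift \<Rightarrow> 'b rees_shift" where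
  "rees_shift_mul n p mul (Shift i) (Shift j) = Shift ((i + j) mod n)"
| "rees_shift_mul n p mul (Shift k) (Triple i t j) = Triple ((k + i) mod n) t j"
| "rees_shift_mul n p mul (Triple i t j) (Shift k) = Triple i t ((j + k) mod n)"
| "rees_shift_mul n p mul (Triple i t j) (Triple k s l) =
    Triple i (mul (mul t (p ((j + k) mod n))) s) l"

definition rees_shift_carrier :: "nat \<Rightarrow> 'b set \<Rightarrow> 'b rees_shift set" where
  "rees_shift_carrier n M =
    Shift ` {..<n} \<union> (\<lambda>(i, t, j). Triple i t j) ` ({..<n} \<times> M \<times> {..<n})"

lemma Shift_in_rees_shift_carrier [simp]: "Shift i \<in> rees_shift_carrier n M \<longleftrightarrow> i < n"
  by (auto simp: rees_shift_carrier_def)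

lemma Triple_in_rees_shift_carrier [simp]:
  "Triple i t j \<in> rees_shift_carrier n M \<longleftrightarrow> i < n \<and> t \<in> M \<and> j < n"
  by (force simp: rees_shift_carrier_def)

lemma finite_rees_shift_carrier: "finite M \<Longrightarrow> finite (rees_shift_carrier n M)"
  by (simp add: rees_shift_carrier_def)

locale rees_shift = regular_monoid_on +
  fixes n :: nat and p :: "nat \<Rightarrow> 'a"
  assumes p_image: "p ` {..<n} = M"
begin

abbreviation "R \<equiv> rees_shift_carrier n M"
abbreviation "rmul \<equiv> rees_shift_mul n p (\<cdot>)"

lemma n_pos: "0 < n"
  using p_image unit_closed by (cases n) auto

lemma p_mod_closed [simp]: "p (k mod n) \<in> M"
  using n_pos p_image by auto

lemma rmul_closed: "x \<in> R \<Longrightarrow> y \<in> R \<Longrightarrow> rmul x y \<in> R"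
  by (cases x; cases y) (auto simp: n_pos closed)

text \<open>The decisive case is a shift between two triples: the sandwich entry depends only on the
  sum of its indices, so the shift may act on either neighbour.\<close>

lemma rmul_assoc: "x \<in> R \<Longrightarrow> y \<in> R \<Longrightarrow> z \<in> R \<Longrightarrow> rmul (rmul x y) z = rmul x (rmul y z)"
  by (cases x; cases y; cases z) (auto simp: closed assoc mod_simps add.assoc)

sublocale rees: semigroup_on R rmul
  by unfold_locales (fact rmul_closed rmul_assoc)+

text \<open>Row \<open>j\<close> is a cyclic rotation of the list \<open>p\<close>, which exhausts
  \<open>M\<close>. By symmetry of the matrix the same holds for columns.\<close>

lemma ex_unit_entry:
  assumes "j < n" obtains k where "k < n" "p ((j + k) mod n) = e"
proof -
  from p_image unit_closed obtain k0 where k0: "k0 < n" "p k0 = e" by auto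
  \<comment> \<open>This is \<open>k0 - j\<close> modulo \<open>n\<close>, written so that
    subtraction on naturals does not truncate.\<close>
  define k where "k = (k0 + (n - j)) mod n"
  have "(j + k) mod n = (j + (k0 + (n - j))) mod n" by (simp add: k_def mod_simps)
  also have "j + (k0 + (n - j)) = k0 + n" using assms by simp
  finally have "(j + k) mod n = k0" using k0 by simp
  with k0 n_pos that[of k] show thesis by (simp add: k_def)
qed

lemma rees_regular: "regular_semigroup R rmul"
  unfolding regular_semigroup_def
proof
  fix a assume a: "a \<in> R"
  show "\<exists>x\<in>R. a = rmul (rmul a x) a"
  proof (cases a)
    case (Shift i)
    \<comment> \<open>The inverse in the cyclic group; reducing modulo \<open>n\<close> matters for
      \<open>i = 0\<close>.\<close>
    with a have "rmul (rmul a (Shift ((n - i) mod n))) a = a"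
      by (simp add: mod_simps)
    with n_pos show ?thesis by (intro bexI[of _ "Shift ((n - i) mod n)"]) auto
  next
    case (Triple i t j)
    with a have t: "i < n" "t \<in> M" "j < n" by auto
    \<comment> \<open>With unit entries at \<open>(j, k)\<close> and \<open>(l, i)\<close>, the
      middle component of the product collapses to \<open>t \<cdot> s \<cdot> t\<close>.\<close>
    obtain k where k: "k < n" "p ((j + k) mod n) = e" using ex_unit_entry t by blast
    obtain l where l: "l < n" "p ((i + l) mod n) = e" using ex_unit_entry t by blast
    obtain s where s: "s \<in> M" "t = t \<cdot> s \<cdot> t"
      using regular t unfolding regular_semigroup_def by blast
    have "rmul (rmul a (Triple k s l)) a = a"
      using k l s t Triple by (simp add: closed unit_right add.commute)
    with k l s show ?thesis by (intro bexI[of _ "Triple k s l"]) auto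
  qed
qed

lemma rees_two_generated: "two_generated R rmul"
proof -
  \<comment> \<open>For \<open>n = 1\<close> the index 1 would be out of range, hence
    \<open>1 mod n\<close>.\<close>
  define c where "c = (Shift (1 mod n) :: 'a rees_shift)"
  define x where "x = Triple 0 e 0"
  let ?G = "subsemigroup_generated rmul {c, x}"
  have cR: "c \<in> R" and xR: "x \<in> R"
    using n_pos unit_closed by (auto simp: c_def x_def)
  have c: "c \<in> ?G" and x: "x \<in> ?G"
    by (auto intro: subsemigroup_generated.base)
  have pow: "Shift (Suc i mod n) \<in> ?G" for i
  proof (induction i)
    case 0
    show ?case using c by (simp add: c_def)
  next
    case (Suc i)
    have "rmul (Shift (Suc i mod n)) c = Shift (Suc (Suc i) mod n)"
      unfolding c_def rees_shift_mul.simps mod_add_eq by simp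
    with subsemigroup_generated.mult[OF Suc c] show ?case by simp
  qed
  have shift: "Shift i \<in> ?G" if "i < n" for i
    \<comment> \<open>A semigroup has no empty product, so \<open>Shift i\<close> is taken as the
      power of \<open>c\<close> with positive exponent \<open>i + n\<close>; this covers
      \<open>i = 0\<close>.\<close>
    using that pow[of "i + n - 1"] by simp
  have corner: "Triple 0 t 0 \<in> ?G" if "t \<in> M" for t
  proof -
    from that p_image obtain k where k: "k < n" "t = p k" by auto
    have "rmul (rmul x (Shift k)) x = Triple 0 t 0"
      using k that by (simp add: x_def unit_left unit_right)
    with x shift[OF k(1)] show ?thesis
      by (metis subsemigroup_generated.mult)
  qed
  have "Triple i t j \<in> ?G" if "i < n" "t \<in> M" "j < n" for i t j
  proof -
    have "rmul (rmul (Shift i) (Triple 0 t 0)) (Shift j) = Triple i t j"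
      using that by simp
    with shift[OF that(1)] shift[OF that(3)] corner[OF that(2)] show ?thesis
      by (metis subsemigroup_generated.mult)
  qed
  then have "R \<subseteq> ?G"
    using shift by (auto simp: rees_shift_carrier_def)
  moreover have "y \<in> R" if "y \<in> ?G" for y
    using that by induction (use cR xR rmul_closed in auto)
  ultimately show ?thesis
    unfolding two_generated_def using cR xR by blast
qed

text \<open>Triples with fixed outer indices 0 and \<open>k\<close> multiply through the single
  entry at \<open>(k, 0)\<close>; when it is the unit they form a copy of \<open>M\<close>.\<close>

lemma rees_embedding: "\<exists>h. semigroup_embedding M (\<cdot>) R rmul h"
proof -
  obtain k where k: "k < n" "p ((0 + k) mod n) = e" using ex_unit_entry n_pos by blast
  then have "semigroup_embedding M (\<cdot>) R rmul (\<lambda>t. Triple 0 t k)"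
    using n_pos
    by (auto simp: semigroup_embedding_def semigroup_hom_on_def inj_on_def unit_right)
  then show ?thesis by blast
qed

end

section \<open>Full transformation monoids\<close>

lemma full_transformation_regular:
  "regular_semigroup (X \<rightarrow>\<^sub>E X) (compose X)"
  unfolding regular_semigroup_def
proof
  fix f assume f: "f \<in> X \<rightarrow>\<^sub>E X"
  \<comment> \<open>A right inverse of \<open>f\<close> on its image, extended by the identity to a
    map of \<open>X\<close> into itself.\<close>
  define g where "g = (\<lambda>y\<in>X. if y \<in> f ` X then inv_into X f y else y)"
  have "g \<in> X \<rightarrow>\<^sub>E X"
    by (auto simp: g_def inv_into_into)
  moreover have "f = compose X (compose X f g) f"
  proof
    fix x
    show "f x = compose X (compose X f g) f x"
    proof (cases "x \<in> X")
      case True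
      with f have "f x \<in> X" by auto
      with True show ?thesis by (simp add: compose_def g_def f_inv_into_f)
    next
      case False
      with f show ?thesis by (simp add: compose_def PiE_def extensional_def)
    qed
  qed
  ultimately show "\<exists>g\<in>X \<rightarrow>\<^sub>E X. f = compose X (compose X f g) f" by blast
qed

lemma full_transformation_monoid:
  "regular_monoid_on (X \<rightarrow>\<^sub>E X) (compose X) (\<lambda>x\<in>X. x)"
proof unfold_locales
  fix f g h assume fgh: "f \<in> X \<rightarrow>\<^sub>E X" "g \<in> X \<rightarrow>\<^sub>E X" "h \<in> X \<rightarrow>\<^sub>E X"
  then show "compose X (compose X f g) h = compose X f (compose X g h)"
    by (intro ext) (auto simp: compose_def)
next
  fix f assume "f \<in> X \<rightarrow>\<^sub>E X"
  then show "compose X (\<lambda>x\<in>X. x) f = f" "compose X f (\<lambda>x\<in>X. x) = f"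
    by (auto simp: compose_def PiE_def extensional_def fun_eq_iff)
qed (auto simp: compose_def full_transformation_regular)

text \<open>\<open>None\<close> plays the adjoined identity: evaluating the left multiplication
  there recovers the element, which gives injectivity.\<close>

lemma left_regular_representation:
  assumes "semigroup_on S mul"
  defines "X \<equiv> insert None (Some ` S)"
  shows "\<exists>h. semigroup_embedding S mul (X \<rightarrow>\<^sub>E X) (compose X) h"
proof
  interpret semigroup_on S mul by (fact assms(1))
  define h where "h s = (\<lambda>x\<in>X. Some (case x of None \<Rightarrow> s | Some y \<Rightarrow> mul s y))" for s
  have "h s \<in> X \<rightarrow>\<^sub>E X" if "s \<in> S" for s
    using that by (auto simp: h_def X_def closed)
  moreover have "h (mul s t) = compose X (h s) (h t)" if "s \<in> S" "t \<in> S" for s t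
    using that by (intro ext) (auto simp: h_def X_def compose_def closed assoc)
  moreover have "s = t" if "h s = h t" for s t
    using fun_cong[OF that, of None] by (simp add: h_def X_def)
  ultimately show "semigroup_embedding S mul (X \<rightarrow>\<^sub>E X) (compose X) h"
    by (auto simp: semigroup_embedding_def semigroup_hom_on_def inj_on_def)
qed

theorem theorem1p3:
  fixes S :: "'a set" and mul :: "'a \<Rightarrow> 'a \<Rightarrow> 'a"
  assumes "semigroup_on S mul" and "finite S"
  shows "\<exists>(T :: nat set) (mul' :: nat \<Rightarrow> nat \<Rightarrow> nat) (h :: 'a \<Rightarrow> nat).
           semigroup_on T mul' \<and> finite T \<and> regular_semigroup T mul' \<and> two_generated T mul' \<and>
           semigroup_embedding S mul T mul' h"
proof -
  define X where "X = insert None (Some ` S)"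
  define M where "M = (X \<rightarrow>\<^sub>E X)"
  have "finite M"
    using assms(2) by (auto simp: M_def X_def intro: finite_PiE)
  then obtain p where p: "p ` {..<card M} = M"
    by (metis bij_betw_imp_surj_on ex_bij_betw_nat_finite lessThan_atLeast0)
  interpret regular_monoid_on M "compose X" "\<lambda>x\<in>X. x"
    unfolding M_def by (fact full_transformation_monoid)
  interpret rees_shift M "compose X" "\<lambda>x\<in>X. x" "card M" p
    by unfold_locales (fact p)
  obtain f where f: "semigroup_embedding S mul M (compose X) f"
    using left_regular_representation[OF assms(1)] unfolding M_def X_def by blast
  obtain g where g: "semigroup_embedding M (compose X) R rmul g"
    using rees_embedding by blast
  show ?thesis
    using semigroup_transport_nat[OF rees.semigroup_on_axioms
        finite_rees_shift_carrier[OF \<open>finite M\<close>] rees_regular rees_two_generated]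
      semigroup_embedding_comp[OF semigroup_embedding_comp[OF f g]]
    by metis
qed

end
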